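(* Let $p$ be a prime and let $\varGamma(\mathbb{Z}_{p^3})$ be the zero divisor graph of $\mathbb{Z}_{p^3}$. Then the independence polynomial of $\varGamma(\mathbb{Z}_{p^3})$ is $$I(\varGamma(\mathbb{Z}_{p^3}), x) = (1+x)^{p^2-p} + (1+(p-1)x) - 1 = (1+x)^{p^2-p} + (p-1)x.$$
   Context: For a positive integer $n$, the zero divisor graph $\varGamma(\mathbb{Z}_n)$ is the simple undirected graph whose vertices are the non-zero zero divisors of the ring $\mathbb{Z}_n$ of integers modulo $n$ (non-zero $a$ such that $ab=0$ for some non-zero $b$), two distinct vertices $a,b$ being adjacent if and only if $ab=0$ in $\mathbb{Z}_n$. An independent set of a finite graph $G$ is a set of vertices no two of which are adjacent (the empty set included); $\alpha(G)$ is the maximum size of an independent set, and $s_k(G)$ is the number of independent sets of size $k$. The independence polynomial of $G$ is $I(G,x)=\sum_{k=0}^{\alpha(G)} s_k(G)x^k$. *)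

theory Defs
  imports
    "HOL-Number_Theory.Residues"
    "HOL-Computational_Algebra.Polynomial"
    "Graph_Theory.Pair_Digraph"
begin

definition nonzero_zero_divisors :: "('a, 'm) ring_scheme \<Rightarrow> 'a set" where
  "nonzero_zero_divisors R =
     {a \<in> carrier R. a \<noteq> \<zero>\<^bsub>R\<^esub> \<and> (\<exists>b \<in> carrier R. b \<noteq> \<zero>\<^bsub>R\<^esub> \<and> a \<otimes>\<^bsub>R\<^esub> b = \<zero>\<^bsub>R\<^esub>)}"

text \<open>An undirected edge between \<open>a\<close> and \<open>b\<close> is represented by the two arcs
  \<open>(a, b)\<close> and \<open>(b, a)\<close>.\<close>

definition zero_divisor_graph :: "('a, 'm) ring_scheme \<Rightarrow> 'a pair_pre_digraph" where
  "zero_divisor_graph R =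
     \<lparr> pverts = nonzero_zero_divisors R,
       parcs = {(a, b). a \<in> nonzero_zero_divisors R \<and> b \<in> nonzero_zero_divisors R
                         \<and> a \<noteq> b \<and> a \<otimes>\<^bsub>R\<^esub> b = \<zero>\<^bsub>R\<^esub>} \<rparr>"

definition independent_set :: "('a, 'b) pre_digraph \<Rightarrow> 'a set \<Rightarrow> bool" where
  "independent_set G S \<longleftrightarrow> S \<subseteq> verts G \<and> pairwise (\<lambda>u v. \<not> u \<rightarrow>\<^bsub>G\<^esub> v) S"

definition independence_number :: "('a, 'b) pre_digraph \<Rightarrow> nat" where
  "independence_number G = Max {card S | S. independent_set G S}"

definition num_independent_sets :: "('a, 'b) pre_digraph \<Rightarrow> nat \<Rightarrow> nat" where
  "num_independent_sets G k = card {S. independent_set G S \<and> card S = k}"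

text \<open>\<open>Max\<close> and \<open>card\<close> above have their intended meaning only for graphs with finitely many
  vertices.\<close>

definition independence_poly :: "('a, 'b) pre_digraph \<Rightarrow> int poly" where
  "independence_poly G =
     (\<Sum>k = 0..independence_number G. monom (int (num_independent_sets G k)) k)"

lemma pair_graph_zero_divisor_graph:
  assumes "cring R" and "finite (carrier R)"
  shows "pair_graph (zero_divisor_graph R)"
proof -
  have fin: "finite (nonzero_zero_divisors R)"
    using assms(2) by (simp add: nonzero_zero_divisors_def)
  have "parcs (zero_divisor_graph R) \<subseteq> nonzero_zero_divisors R \<times> nonzero_zero_divisors R"
    by (auto simp: zero_divisor_graph_def)
  then have fin': "finite (parcs (zero_divisor_graph R))"
    using fin finite_subset by blast
  have sym: "symmetric (zero_divisor_graph R)"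
    using cring.cring_simprules(14)[OF assms(1)]
    by (auto simp: symmetric_def sym_def zero_divisor_graph_def nonzero_zero_divisors_def)
  show ?thesis
    by unfold_locales
      (use fin fin' sym in \<open>auto simp: zero_divisor_graph_def\<close>)
qed

end

theory Submission
  imports Defs
begin

text \<open>Split the vertices of the zero divisor graph of the integers modulo \<open>p\<^sup>3\<close> into the set \<open>A\<close> of
  those divisible by \<open>p\<close> exactly once and the set \<open>B\<close> of non-zero multiples of \<open>p\<^sup>2\<close>. Distinct
  vertices are adjacent iff one of them lies in \<open>B\<close>, so the independent sets are the subsets of \<open>A\<close>
  and the singletons in \<open>B\<close>. The former contribute \<open>(1 + x) ^ card A\<close> and the latter
  \<open>card B\<close> times \<open>x\<close>.\<close>

text \<open>Grouping the independent sets by size turns each coefficient into a sum of equal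
  monomials. In the ungrouped form the sum can be split along a partition of the family of
  independent sets.\<close>

lemma independence_poly_eq_sum_independent_sets:
  assumes "finite (verts G)"
  shows "independence_poly G = (\<Sum>S | independent_set G S. monom 1 (card S))"
proof -
  let ?I = "{S. independent_set G S}"
  have "?I \<subseteq> Pow (verts G)"
    by (auto simp: independent_set_def)
  then have fin: "finite ?I"
    using assms by (meson finite_Pow_iff finite_subset)
  \<comment> \<open>Finiteness of \<open>?I\<close> makes the \<open>Max\<close> genuine, so no size
    is lost by stopping at the independence number.\<close>
  have bound: "card ` ?I \<subseteq> {0..independence_number G}"
    using fin by (auto simp: independence_number_def setcompr_eq_image)
  have "(\<Sum>S\<in>?I. monom (1::int) (card S))
      = (\<Sum>k = 0..independence_number G. \<Sum>S\<in>{S \<in> ?I. card S = k}. monom 1 (card S))"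
    by (rule sum.group[OF fin _ bound, symmetric]) simp
  also have "\<dots> = independence_poly G"
    by (auto simp: independence_poly_def num_independent_sets_def of_nat_poly smult_monom
        intro!: sum.cong)
  finally show ?thesis ..
qed

text \<open>Each subset of \<open>insert a A\<close> either omits \<open>a\<close> or arises by
  adding \<open>a\<close> to a subset of \<open>A\<close>, which costs one more factor x. Every new
  element thus multiplies the sum by 1 + x, written \<open>[:1, 1:]\<close>.\<close>

lemma sum_monom_card_Pow:
  assumes "finite A"
  shows "(\<Sum>S\<in>Pow A. monom 1 (card S)) = ([:1, 1:] :: 'a::comm_semiring_1 poly) ^ card A"
  using assms
proof (induction A)
  case empty
  then show ?case by simp
next
  case (insert a A)
  have inj: "inj_on (insert a) (Pow A)"
    using insert.hyps(2) by (auto simp: inj_on_def)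
  have card: "card (insert a S) = Suc (card S)" if "S \<in> Pow A" for S
    using that insert.hyps finite_subset[of S A] by (auto intro!: card_insert_disjoint)
  have "(\<Sum>S\<in>Pow (insert a A). monom (1::'a) (card S))
      = (\<Sum>S\<in>Pow A. monom 1 (card S)) + (\<Sum>S\<in>Pow A. monom 1 (card (insert a S)))"
    unfolding Pow_insert using insert.hyps
    by (subst sum.union_disjoint) (auto simp: sum.reindex[OF inj])
  also have "\<dots> = (\<Sum>S\<in>Pow A. monom 1 (card S)) + (\<Sum>S\<in>Pow A. pCons 0 (monom 1 (card S)))"
    using card by (simp add: monom_Suc)
  also have "\<dots> = [:1, 1:] * (\<Sum>S\<in>Pow A. monom 1 (card S))"
    by (simp add: sum_distrib_left flip: sum.distrib)
  finally show ?case
    using insert by simp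
qed

text \<open>Here \<open>G\<close> is the join of the edgeless graph on \<open>A\<close> and the
  complete graph on \<open>B\<close>; this separates the counting of independent sets from all
  arithmetic.\<close>

lemma independence_poly_dominating:
  assumes "finite A" "finite B" "A \<inter> B = {}" "verts G = A \<union> B"
    and adj: "\<And>u v. u \<in> A \<union> B \<Longrightarrow> v \<in> A \<union> B \<Longrightarrow> u \<noteq> v \<Longrightarrow>
                 u \<rightarrow>\<^bsub>G\<^esub> v \<longleftrightarrow> u \<in> B \<or> v \<in> B"
  shows "independence_poly G = [:1, 1:] ^ card A + [:0, int (card B):]"
proof -
  have "independent_set G S \<longleftrightarrow> S \<in> Pow A \<union> (\<lambda>b. {b}) ` B" for S
  proof
    assume S: "independent_set G S"
    show "S \<in> Pow A \<union> (\<lambda>b. {b}) ` B"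
    proof (cases "S \<subseteq> A")
      case False
      then obtain b where b: "b \<in> S" "b \<in> B"
        using S assms(4) by (auto simp: independent_set_def)
      have "v = b" if "v \<in> S" for v
      proof (rule ccontr)
        assume "v \<noteq> b"
        moreover have "v \<in> A \<union> B"
          using S that assms(4) by (auto simp: independent_set_def)
        ultimately have "b \<rightarrow>\<^bsub>G\<^esub> v"
          using b by (simp add: adj)
        with S b(1) that \<open>v \<noteq> b\<close> show False
          by (simp add: independent_set_def pairwise_def)
      qed
      with b have "S = {b}" by blast
      with b show ?thesis by simp
    qed simp
  next
    assume "S \<in> Pow A \<union> (\<lambda>b. {b}) ` B"
    then show "independent_set G S"
    proof
      assume "S \<in> Pow A"
      moreover have "\<not> u \<rightarrow>\<^bsub>G\<^esub> v" if "u \<in> A" "v \<in> A" "u \<noteq> v" for u v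
        using that adj[of u v] assms(3) by auto
      ultimately show ?thesis
        using assms(4) unfolding independent_set_def pairwise_def by blast
    next
      assume "S \<in> (\<lambda>b. {b}) ` B"
      then show ?thesis
        using assms(4) by (auto simp: independent_set_def)
    qed
  qed
  then have sets: "{S. independent_set G S} = Pow A \<union> (\<lambda>b. {b}) ` B"
    by blast
  \<comment> \<open>The two families are disjoint: a singleton from \<open>B\<close> is not a subset
    of \<open>A\<close>, and the empty set belongs to \<open>Pow A\<close> only.\<close>
  have "independence_poly G
      = (\<Sum>S\<in>Pow A. monom 1 (card S)) + (\<Sum>S\<in>(\<lambda>b. {b}) ` B. monom 1 (card S))"
    using assms(1-4)
    by (subst independence_poly_eq_sum_independent_sets, simp, unfold sets, intro sum.union_disjoint) auto
  also have "(\<Sum>S\<in>(\<lambda>b. {b}) ` B. monom 1 (card S)) = [:0, int (card B):]"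
    by (simp add: sum.reindex monom_Suc monom_0 of_nat_poly)
  finally show ?thesis
    by (simp add: sum_monom_card_Pow assms(1))
qed

text \<open>Multiplication by \<open>d\<close> maps \<open>{0..<m}\<close> bijectively onto these
  multiples, 0 included.\<close>

lemma card_multiples:
  fixes d m :: int
  assumes "d > 0" "m \<ge> 0"
  shows "card {a \<in> {0..<d * m}. d dvd a} = nat m"
proof -
  have "{a \<in> {0..<d * m}. d dvd a} = (*) d ` {0..<m}"
    using assms by (auto simp: dvd_def zero_le_mult_iff)
  moreover have "inj_on ((*) d) {0..<m}"
    using assms by (simp add: inj_on_def)
  ultimately show ?thesis
    by (simp add: card_image)
qed

text \<open>Cancelling one factor \<open>q\<close> from each of \<open>a\<close> and
  \<open>b\<close> leaves the question whether \<open>q\<close> divides the product of the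
  cofactors, which primality decides.\<close>

lemma prime_cube_dvd_mult_iff:
  fixes q a b :: int
  assumes "prime q" "q dvd a" "q dvd b"
  shows "q ^ 3 dvd a * b \<longleftrightarrow> q\<^sup>2 dvd a \<or> q\<^sup>2 dvd b"
proof -
  obtain a' b' where ab: "a = q * a'" "b = q * b'"
    using assms(2,3) by (auto simp: dvd_def)
  have q: "q \<noteq> 0"
    using assms(1) by auto
  have "q ^ 3 dvd a * b \<longleftrightarrow> q\<^sup>2 * q dvd q\<^sup>2 * (a' * b')"
    by (simp add: ab power2_eq_square power3_eq_cube mult_ac)
  also have "\<dots> \<longleftrightarrow> q dvd a' \<or> q dvd b'"
    using q assms(1) by (simp add: prime_dvd_mult_iff)
  also have "\<dots> \<longleftrightarrow> q\<^sup>2 dvd a \<or> q\<^sup>2 dvd b"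
    using q by (simp add: ab power2_eq_square)
  finally show ?thesis .
qed

text \<open>An element not divisible by \<open>q\<close> is coprime to the modulus, so it can
  annihilate only 0.\<close>

lemma nonzero_zero_divisors_residue_ring_prime_power:
  fixes q :: int
  assumes "prime q" "k \<ge> 2"
  shows "nonzero_zero_divisors (residue_ring (q ^ k)) = {a \<in> {0<..<q ^ k}. q dvd a}"
proof (intro subset_antisym subsetI)
  fix a assume "a \<in> nonzero_zero_divisors (residue_ring (q ^ k))"
  then obtain b where "a \<in> {0..q ^ k - 1}" "a \<noteq> 0" "b \<in> {0..q ^ k - 1}" "b \<noteq> 0"
      "a * b mod q ^ k = 0"
    unfolding nonzero_zero_divisors_def residue_ring_def by auto
  then have a: "a \<in> {0<..<q ^ k}" and b: "b \<in> {0<..<q ^ k}" and ab: "q ^ k dvd a * b"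
    by auto
  have "q dvd a"
  proof (rule ccontr)
    assume "\<not> q dvd a"
    then have "coprime (q ^ k) a"
      using assms(1) by (simp add: prime_imp_coprime)
    with ab have "q ^ k dvd b"
      by (simp add: coprime_dvd_mult_right_iff)
    with b show False
      using zdvd_imp_le by force
  qed
  with a show "a \<in> {a \<in> {0<..<q ^ k}. q dvd a}"
    by simp
next
  fix a assume "a \<in> {a \<in> {0<..<q ^ k}. q dvd a}"
  then have a: "a \<in> {0<..<q ^ k}" and "q dvd a"
    by auto
  obtain j where k: "k = Suc j"
    using assms(2) by (cases k) auto
  have q: "q > 1"
    using assms(1) by (simp add: prime_gt_1_int)
  \<comment> \<open>The annihilating witness is \<open>q ^ j\<close> with \<open>j = k - 1\<close>:
    the one missing factor \<open>q\<close> is supplied by \<open>a\<close>.\<close>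
  have "a * q ^ j mod q ^ k = 0"
    using \<open>q dvd a\<close> by (simp add: k mult_dvd_mono flip: dvd_eq_mod_eq_0)
  moreover have "0 < q ^ j" "q ^ j < q ^ k"
    using q by (simp_all add: k)
  ultimately show "a \<in> nonzero_zero_divisors (residue_ring (q ^ k))"
    using a by (auto simp: nonzero_zero_divisors_def residue_ring_def intro!: bexI[of _ "q ^ j"])
qed

theorem proposition2p1:
  fixes p :: nat
  assumes "prime p"
  shows "independence_poly (zero_divisor_graph (residue_ring (int (p ^ 3))))
           = [:1, 1:] ^ (p ^ 2 - p) + [:1, int p - 1:] - 1
       \<and> [:1, 1:] ^ (p ^ 2 - p) + [:1, int p - 1:] - 1
           = [:1, 1:] ^ (p ^ 2 - p) + [:0, int p - 1:]"
proof -
  define q where "q = int p"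
  define M where "M d = {a \<in> {0..<q ^ 3}. d dvd a}" for d
  \<comment> \<open>\<open>M d\<close> contains 0. It disappears from \<open>A\<close> because it
    also lies in \<open>M (q\<^sup>2)\<close>, but must be removed from \<open>B\<close> by
    hand.\<close>
  define A where "A = M q - M (q\<^sup>2)"
  define B where "B = M (q\<^sup>2) - {0}"
  let ?R = "residue_ring (q ^ 3)"
  have q: "prime q" "q > 0"
    using assms by (auto simp: q_def prime_gt_0_nat)
  have sub: "M (q\<^sup>2) \<subseteq> M q"
    by (auto simp: M_def power2_eq_square dest: dvd_mult_left)
  have fin: "finite (M d)" for d
    by (auto simp: M_def intro: finite_subset[of _ "{0..<q ^ 3}"])
  have q3: "q ^ 3 = q * q\<^sup>2" "q ^ 3 = q\<^sup>2 * q"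
    by (simp_all add: power2_eq_square power3_eq_cube)
  have "card (M q) = nat (q\<^sup>2)"
    unfolding M_def q3(1) by (rule card_multiples) (use q(2) in simp_all)
  moreover have "card (M (q\<^sup>2)) = nat q"
    unfolding M_def q3(2) by (rule card_multiples) (use q(2) in simp_all)
  ultimately have "card (M q) = p\<^sup>2" and M2: "card (M (q\<^sup>2)) = p"
    by (simp_all add: q_def nat_power_eq)
  then have A: "card A = p\<^sup>2 - p"
    using sub by (simp add: A_def card_Diff_subset fin)
  have "card B = p - 1"
    using M2 q(2) by (simp add: B_def M_def fin)
  \<comment> \<open>Since p is positive, the truncated difference \<open>p - 1\<close> agrees with
    the integer one.\<close>
  then have B: "int (card B) = int p - 1"
    using assms prime_gt_0_nat[of p] by simp
  have zd: "nonzero_zero_divisors ?R = A \<union> B"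
    using sub q
    by (auto simp: nonzero_zero_divisors_residue_ring_prime_power A_def B_def M_def
        order.order_iff_strict power2_eq_square dest: dvd_mult_left)
  have "independence_poly (zero_divisor_graph ?R) = [:1, 1:] ^ card A + [:0, int (card B):]"
  proof (rule independence_poly_dominating)
    show "verts (zero_divisor_graph ?R) = A \<union> B"
      by (simp add: zero_divisor_graph_def zd)
    fix u v assume uv: "u \<in> A \<union> B" "v \<in> A \<union> B" "u \<noteq> v"
    have "u \<otimes>\<^bsub>?R\<^esub> v = \<zero>\<^bsub>?R\<^esub> \<longleftrightarrow> q ^ 3 dvd u * v"
      by (simp add: residue_ring_def dvd_eq_mod_eq_0)
    then have "u \<rightarrow>\<^bsub>zero_divisor_graph ?R\<^esub> v \<longleftrightarrow> q ^ 3 dvd u * v"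
      using uv by (simp add: zero_divisor_graph_def zd)
    also have "\<dots> \<longleftrightarrow> q\<^sup>2 dvd u \<or> q\<^sup>2 dvd v"
      using uv sub q(1) by (intro prime_cube_dvd_mult_iff) (auto simp: A_def B_def M_def)
    \<comment> \<open>No vertex is 0, so among the vertices divisibility by \<open>q\<^sup>2\<close>
      is membership in \<open>B\<close>.\<close>
    also have "\<dots> \<longleftrightarrow> u \<in> B \<or> v \<in> B"
      using uv by (auto simp: A_def B_def M_def)
    finally show "u \<rightarrow>\<^bsub>zero_divisor_graph ?R\<^esub> v \<longleftrightarrow> u \<in> B \<or> v \<in> B" .
  qed (auto simp: A_def B_def fin)
  then have "independence_poly (zero_divisor_graph (residue_ring (int (p ^ 3))))
      = [:1, 1:] ^ (p\<^sup>2 - p) + [:0, int p - 1:]"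
    by (simp add: A B q_def)
  then show ?thesis
    by (simp add: one_pCons)
qed

end
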